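(* Let $p\ge 7$ be a prime. The group $$G:=\langle x,y,z\mid x^p,\ y^p,\ z^p,\ [x,y]=z\rangle$$ is a non-abelian Beauville group of order $p^3$ with Beauville structure $\{\{x,y\},\{xy^2,xy^3\}\}$.
   Context: Let $G$ be a finite group with identity $e$. For $x,y\in G$ put $$\Sigma(x,y):=\bigcup_{i=1}^{|G|}\bigcup_{g\in G}\{(x^i)^g,(y^i)^g,((xy)^i)^g\},$$ where $a^g$ denotes the conjugate $g^{-1}ag$. A Beauville structure for $G$ is a pair of generating sets $\{x_1,y_1\},\{x_2,y_2\}$ of $G$ (i.e. $\langle x_1,y_1\rangle=\langle x_2,y_2\rangle=G$) such that $\Sigma(x_1,y_1)\cap\Sigma(x_2,y_2)=\{e\}$. $G$ is a Beauville group if there exists a Beauville structure for $G$. Presentation conventions: $[a,b]=aba^{-1}b^{-1}$, and relations $[a,b]=e$ between commuting generators are omitted, i.e. any two generators whose commutator is not specified by a listed relation are understood to commute. Thus here $z$ commutes with $x$ and with $y$. *)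

theory Defs
  imports
    "HOL-Computational_Algebra.Primes"
    "HOL-Algebra.Generated_Groups"
begin

section \<open>Free groups\<close>

text \<open>
  The letter \<open>(a, True)\<close> stands for the generator \<open>a\<close>, the letter \<open>(a, False)\<close> for its inverse.
  The free group on the type \<open>'a\<close> consists of the classes of words modulo insertion and
  deletion of mutually inverse neighbouring letters.
\<close>

type_synonym 'a word = "('a \<times> bool) list"

inductive cancels :: "'a word \<Rightarrow> 'a word \<Rightarrow> bool" where
  "cancels (u @ [(a, b), (a, \<not> b)] @ v) (u @ v)"

definition word_class :: "'a word \<Rightarrow> 'a word set" where
  "word_class u = {v. equivclp cancels u v}"

definition free_group :: "'a word set monoid" where
  "free_group = \<lparr>carrier = range word_class,
                 mult = (\<lambda>A B. \<Union>u\<in>A. \<Union>v\<in>B. word_class (u @ v)),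
                 one = word_class []\<rparr>"

definition free_gen :: "'a \<Rightarrow> 'a word set" where
  "free_gen a = word_class [(a, True)]"

lemma equivclp_cancels_ctxt:
  assumes "equivclp cancels u v"
  shows "equivclp cancels (s @ u @ t) (s @ v @ t)"
  using assms
proof (induction rule: equivclp_induct)
  case (step y z)
  have ctxt: "cancels (s @ c @ t) (s @ d @ t)" if "cancels c d" for c d
    using that
  proof cases
    case (1 u a b v)
    then show ?thesis
      using cancels.intros[of "s @ u" a b "v @ t"] by simp
  qed
  from step.hyps(2) have "equivclp cancels (s @ y @ t) (s @ z @ t)"
    by (meson ctxt equivclp_sym r_into_equivclp)
  with step.IH show ?case
    by (meson equivclp_trans)
qed simp

lemma equivclp_cancels_append:
  assumes "equivclp cancels u u'" and "equivclp cancels v v'"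
  shows "equivclp cancels (u @ v) (u' @ v')"
proof (rule equivclp_trans)
  show "equivclp cancels (u @ v) (u' @ v)"
    using equivclp_cancels_ctxt[OF assms(1), of "[]" v] by (simp only: append_Nil)
  show "equivclp cancels (u' @ v) (u' @ v')"
    using equivclp_cancels_ctxt[OF assms(2), of u' "[]"] by (simp only: append_Nil2)
qed

lemma word_class_eq_iff: "word_class u = word_class v \<longleftrightarrow> equivclp cancels u v"
proof
  assume "word_class u = word_class v"
  moreover have "v \<in> word_class v" by (simp add: word_class_def)
  ultimately have "v \<in> word_class u" by simp
  then show "equivclp cancels u v" by (simp add: word_class_def)
next
  assume "equivclp cancels u v"
  then have "equivclp cancels u w \<longleftrightarrow> equivclp cancels v w" for w
    by (meson equivclp_sym equivclp_trans)
  then show "word_class u = word_class v" by (simp add: word_class_def)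
qed

lemma free_group_mult [simp]:
  "word_class u \<otimes>\<^bsub>free_group\<^esub> word_class v = word_class (u @ v)"
proof -
  have "word_class (u' @ v') = word_class (u @ v)"
    if "u' \<in> word_class u" "v' \<in> word_class v" for u' v'
    using that equivclp_cancels_append[of u u' v v']
    by (simp add: word_class_eq_iff) (simp add: word_class_def equivclp_sym)
  then have "(\<Union>u'\<in>word_class u. \<Union>v'\<in>word_class v. word_class (u' @ v')) =
      (\<Union>u'\<in>word_class u. \<Union>v'\<in>word_class v. word_class (u @ v))"
    by (intro SUP_cong refl)
  moreover have "word_class w \<noteq> {}" for w :: "'a word"
    using equivclp_refl[of cancels w] unfolding word_class_def by blast
  ultimately show ?thesis
    by (simp add: free_group_def)
qed

lemma free_group_one: "\<one>\<^bsub>free_group\<^esub> = word_class []"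
  by (simp add: free_group_def)

lemma free_group_carrier: "carrier free_group = range word_class"
  by (simp add: free_group_def)

lemma word_class_inverse: "word_class (map (\<lambda>(a, b). (a, \<not> b)) (rev u) @ u) = word_class []"
proof (induction u)
  case (Cons l u)
  obtain a b where l: "l = (a, b)" by (cases l)
  let ?inv = "\<lambda>w :: 'a word. map (\<lambda>(a, b). (a, \<not> b)) (rev w)"
  have "cancels (?inv u @ [(a, \<not> b), (a, \<not> \<not> b)] @ u) (?inv u @ u)"
    by (rule cancels.intros)
  then have "word_class (?inv (l # u) @ l # u) = word_class (?inv u @ u)"
    by (auto simp: l word_class_eq_iff intro: r_into_equivclp)
  with Cons show ?case by simp
qed simp

lemma group_free_group: "group free_group"
proof (rule groupI)
  fix A :: "'a word set"
  assume "A \<in> carrier free_group"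
  then obtain u where "A = word_class u" by (auto simp: free_group_carrier)
  then show "\<exists>B\<in>carrier free_group. B \<otimes>\<^bsub>free_group\<^esub> A = \<one>\<^bsub>free_group\<^esub>"
    by (intro bexI[of _ "word_class (map (\<lambda>(a, b). (a, \<not> b)) (rev u))"])
       (simp_all add: free_group_carrier free_group_one word_class_inverse)
qed (auto simp: free_group_carrier free_group_one)


section \<open>Group presentations\<close>

definition normal_closure :: "('a, 'b) monoid_scheme \<Rightarrow> 'a set \<Rightarrow> 'a set" where
  "normal_closure G R = \<Inter>{N. N \<lhd> G \<and> R \<subseteq> N}"

text \<open>
  The presented group is the quotient of the free group on the whole type \<open>'a\<close> by the normal
  closure of the set of relators \<open>R\<close>.
\<close>

definition presented_group :: "'a word set set \<Rightarrow> 'a word set set monoid" where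
  "presented_group R = free_group Mod normal_closure free_group R"

definition presented_gen :: "'a word set set \<Rightarrow> 'a \<Rightarrow> 'a word set set" where
  "presented_gen R a = normal_closure free_group R #>\<^bsub>free_group\<^esub> free_gen a"

definition commutator :: "('a, 'b) monoid_scheme \<Rightarrow> 'a \<Rightarrow> 'a \<Rightarrow> 'a" where
  "commutator G a b = a \<otimes>\<^bsub>G\<^esub> b \<otimes>\<^bsub>G\<^esub> inv\<^bsub>G\<^esub> a \<otimes>\<^bsub>G\<^esub> inv\<^bsub>G\<^esub> b"

lemma (in group) normal_normal_closure:
  assumes "R \<subseteq> carrier G"
  shows "normal_closure G R \<lhd> G"
proof -
  have carr: "carrier G \<lhd> G"
    by (auto simp: normal_inv_iff subgroup_self)
  have "subgroup (normal_closure G R) G"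
    unfolding normal_closure_def
    using carr assms by (intro subgroups_Inter) (auto simp: normal_imp_subgroup)
  then show ?thesis
    by (auto simp: normal_inv_iff normal_closure_def)
qed

datatype xyz = X | Y | Z

text \<open>
  A relation \<open>v = w\<close> is encoded by the relator \<open>v w\<^sup>-\<^sup>1\<close>.  The last two relators are the
  relations that are left implicit when a presentation omits commuting pairs of generators.
\<close>

definition xyz_relators :: "nat \<Rightarrow> xyz word set set" where
  "xyz_relators p =
    (let F = free_group; x = free_gen X; y = free_gen Y; z = free_gen Z in
      {x [^]\<^bsub>F\<^esub> p, y [^]\<^bsub>F\<^esub> p, z [^]\<^bsub>F\<^esub> p,
       commutator F x y \<otimes>\<^bsub>F\<^esub> inv\<^bsub>F\<^esub> z,
       commutator F x z, commutator F y z})"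

definition xyz_group :: "nat \<Rightarrow> xyz word set set monoid" where
  "xyz_group p = presented_group (xyz_relators p)"

definition xyz_gen :: "nat \<Rightarrow> xyz \<Rightarrow> xyz word set set" where
  "xyz_gen p = presented_gen (xyz_relators p)"


section \<open>Beauville groups\<close>

definition conj_by :: "('a, 'b) monoid_scheme \<Rightarrow> 'a \<Rightarrow> 'a \<Rightarrow> 'a" where
  "conj_by G a g = inv\<^bsub>G\<^esub> g \<otimes>\<^bsub>G\<^esub> a \<otimes>\<^bsub>G\<^esub> g"

definition beauville_Sigma :: "('a, 'b) monoid_scheme \<Rightarrow> 'a \<Rightarrow> 'a \<Rightarrow> 'a set" where
  "beauville_Sigma G x y =
    (\<Union>i\<in>{1..order G}. \<Union>g\<in>carrier G.
      {conj_by G (x [^]\<^bsub>G\<^esub> i) g,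
       conj_by G (y [^]\<^bsub>G\<^esub> i) g,
       conj_by G ((x \<otimes>\<^bsub>G\<^esub> y) [^]\<^bsub>G\<^esub> i) g})"

text \<open>
  \<open>beauville_structure G x1 y1 x2 y2\<close> says that the generating sets \<open>{x1, y1}\<close> and
  \<open>{x2, y2}\<close> form a Beauville structure.  In a group the order inside each set is immaterial,
  since \<open>y x\<close> is conjugate to \<open>x y\<close>.
\<close>

definition beauville_structure ::
    "('a, 'b) monoid_scheme \<Rightarrow> 'a \<Rightarrow> 'a \<Rightarrow> 'a \<Rightarrow> 'a \<Rightarrow> bool" where
  "beauville_structure G x1 y1 x2 y2 \<longleftrightarrow>
    {x1, y1, x2, y2} \<subseteq> carrier G \<and>
    generate G {x1, y1} = carrier G \<and>
    generate G {x2, y2} = carrier G \<and>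
    beauville_Sigma G x1 y1 \<inter> beauville_Sigma G x2 y2 = {\<one>\<^bsub>G\<^esub>}"

definition beauville_group :: "('a, 'b) monoid_scheme \<Rightarrow> bool" where
  "beauville_group G \<longleftrightarrow>
    group G \<and> finite (carrier G) \<and> (\<exists>x1 y1 x2 y2. beauville_structure G x1 y1 x2 y2)"

end

theory Submission
  imports Defs "HOL-Algebra.Multiplicative_Group"
begin

text \<open>
  The relations show that every element of the group is some \<open>x\<^sup>a y\<^sup>b z\<^sup>c\<close>, so its order is at
  most \<open>p\<^sup>3\<close>. The Heisenberg group over \<open>\<int>/p\<close> satisfies the relations and has order \<open>p\<^sup>3\<close>, hence
  the two groups are isomorphic. As \<open>p\<close> is odd, the exponent is \<open>p\<close>. Conjugation acts trivially on
  the abelianisation \<open>(\<int>/p)\<^sup>2\<close>, where the first triple \<open>x\<close>, \<open>y\<close>, \<open>xy\<close> spans the lines through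
  \<open>(1,0)\<close>, \<open>(0,1)\<close>, \<open>(1,1)\<close> and the second triple those through \<open>(1,2)\<close>, \<open>(1,3)\<close>, \<open>(2,5)\<close>. For
  \<open>p \<ge> 7\<close> the lines of the first triple differ from those of the second, so a common element of
  the two unions is conjugate to a power \<open>w\<^sup>i\<close> with \<open>p\<close> dividing \<open>i\<close>, which is trivial.
\<close>

section \<open>Universal property of presentations\<close>

text \<open>Evaluating a word letter by letter in \<open>H\<close> is unaffected by cancelling
  mutually inverse neighbours, so the value depends only on the class of the word.\<close>

lemma free_group_universal:
  assumes "group H" and f: "\<And>a. f a \<in> carrier H"
  obtains h where "h \<in> hom free_group H" "\<And>a. h (free_gen a) = f a"
proof -
  interpret H: group H by fact
  define ev where "ev = (\<lambda>u. foldr (\<lambda>(a, s) r. (if s then f a else inv\<^bsub>H\<^esub> f a) \<otimes>\<^bsub>H\<^esub> r) u \<one>\<^bsub>H\<^esub>)"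
  have ev_Cons: "ev ((a, s) # u) = (if s then f a else inv\<^bsub>H\<^esub> f a) \<otimes>\<^bsub>H\<^esub> ev u" for a s u
    by (simp add: ev_def)
  have ev_Nil: "ev [] = \<one>\<^bsub>H\<^esub>"
    by (simp add: ev_def)
  have ev_closed [simp]: "ev u \<in> carrier H" for u
  proof (induction u)
    case (Cons l u)
    then show ?case by (cases l) (simp add: ev_Cons f)
  qed (simp add: ev_Nil)
  have ev_append: "ev (u @ v) = ev u \<otimes>\<^bsub>H\<^esub> ev v" for u v
  proof (induction u)
    case (Cons l u)
    then show ?case by (cases l) (simp add: ev_Cons f H.m_assoc)
  qed (simp add: ev_Nil)
  have cancel: "inv\<^bsub>H\<^esub> f a \<otimes>\<^bsub>H\<^esub> (f a \<otimes>\<^bsub>H\<^esub> r) = r"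
    "f a \<otimes>\<^bsub>H\<^esub> (inv\<^bsub>H\<^esub> f a \<otimes>\<^bsub>H\<^esub> r) = r"
    if "r \<in> carrier H" for a r
    using that f[of a] by (simp_all flip: H.m_assoc)
  have ev_cancels: "ev u = ev v" if "cancels u v" for u v
    using that by cases (auto simp: ev_append ev_Cons cancel)
  have ev_eq: "ev u = ev v" if "equivclp cancels u v" for u v
    using that by (induction rule: equivclp_induct) (auto dest: ev_cancels)
  \<comment> \<open>Any representative will do, since \<open>ev\<close> is constant on each class by
    \<open>ev_eq\<close>.\<close>
  define h where "h = (\<lambda>A. ev (SOME u. u \<in> A))"
  have h: "h (word_class u) = ev u" for u
  proof -
    have "(SOME v. v \<in> word_class u) \<in> word_class u"
      by (rule someI[of _ u]) (simp add: word_class_def)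
    then show ?thesis
      by (simp add: h_def word_class_def ev_eq)
  qed
  show thesis
  proof
    show "h \<in> hom free_group H"
      by (rule homI) (auto simp: free_group_carrier h ev_append)
    show "h (free_gen a) = f a" for a
      by (simp add: free_gen_def h ev_Cons ev_Nil f)
  qed
qed

lemma free_gen_closed [simp]: "free_gen a \<in> carrier free_group"
  by (simp add: free_gen_def free_group_carrier)

lemma generate_free_gen: "generate free_group (range (free_gen :: 'a \<Rightarrow> _)) = carrier free_group"
proof
  interpret group "free_group :: 'a word set monoid" by (rule group_free_group)
  show "generate free_group (range (free_gen :: 'a \<Rightarrow> _)) \<subseteq> carrier free_group"
    by (rule generate_incl) auto
  have "word_class u \<in> generate free_group (range free_gen)" for u :: "'a word"
  proof (induction u)
    case Nil
    then show ?case by (metis free_group_one generate.one)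
  next
    case (Cons l u)
    obtain a s where l: "l = (a, s)" by (cases l)
    have "word_class [(a, False)] = inv\<^bsub>free_group\<^esub> free_gen a"
      using word_class_inverse[of "[(a, True)]"]
      by (intro inv_equality[symmetric])
        (simp_all add: free_gen_def free_group_carrier free_group_one)
    then have "word_class [(a, s)] \<in> generate free_group (range free_gen)"
      by (cases s) (auto intro: generate.incl generate.inv simp flip: free_gen_def)
    from generate.eng[OF this Cons.IH] show ?case by (simp add: l)
  qed
  then show "carrier free_group \<subseteq> generate free_group (range (free_gen :: 'a \<Rightarrow> _))"
    by (auto simp: free_group_carrier)
qed

context
  fixes R :: "'a word set set"
  assumes R: "R \<subseteq> carrier free_group"
begin

interpretation F: group "free_group :: 'a word set monoid" by (rule group_free_group)

interpretation N: normal "normal_closure free_group R" free_group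
  by (rule F.normal_normal_closure[OF R])

lemma group_presented_group: "group (presented_group R)"
  unfolding presented_group_def by (rule N.factorgroup_is_group)

lemma presented_group_proj_hom:
  "group_hom free_group (presented_group R) (\<lambda>w. normal_closure free_group R #>\<^bsub>free_group\<^esub> w)"
  unfolding group_hom_def group_hom_axioms_def
  using group_free_group group_presented_group N.r_coset_hom_Mod
  by (simp add: presented_group_def)

text \<open>A relator lies in every normal subgroup containing \<open>R\<close>, hence in the normal
  closure, so its coset is the normal closure itself.\<close>

lemma presented_group_proj_relator:
  assumes "r \<in> R"
  shows "normal_closure free_group R #>\<^bsub>free_group\<^esub> r = \<one>\<^bsub>presented_group R\<^esub>"
  using assms N.subgroup_axioms
  by (auto simp: presented_group_def normal_closure_def intro!: subgroup.rcos_const[OF _ group_free_group])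

lemma generate_presented_gen:
  "generate (presented_group R) (range (presented_gen R)) = carrier (presented_group R)"
proof -
  interpret pr: group_hom free_group "presented_group R"
      "\<lambda>w. normal_closure free_group R #>\<^bsub>free_group\<^esub> w"
    by (rule presented_group_proj_hom)
  have "range (presented_gen R) =
      (\<lambda>w. normal_closure free_group R #>\<^bsub>free_group\<^esub> w) ` range free_gen"
    by (auto simp: presented_gen_def)
  then show ?thesis
    using pr.generate_img[of "range free_gen"]
    by (simp add: image_subset_iff generate_free_gen presented_group_def carrier_FactGroup)
qed

text \<open>Von Dyck's theorem: the kernel of the homomorphism extending \<open>f\<close> to the
  free group is normal and contains the relators, hence their normal closure. Relators are classes
  of words, so \<open>rel\<close> says that they hold in \<open>H\<close> by means of such
  extensions \<open>h\<close>.\<close>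

lemma presented_group_universal:
  assumes "group H" and f: "\<And>a. f a \<in> carrier H"
    and rel: "\<And>h r. group_hom free_group H h \<Longrightarrow> (\<And>a. h (free_gen a) = f a) \<Longrightarrow> r \<in> R \<Longrightarrow>
      h r = \<one>\<^bsub>H\<^esub>"
  obtains g where "g \<in> hom (presented_group R) H" "\<And>a. g (presented_gen R a) = f a"
proof -
  obtain h where h: "h \<in> hom free_group H" "\<And>a. h (free_gen a) = f a"
    using free_group_universal[of H f] assms(1) f by blast
  interpret h: group_hom free_group H h
    using h(1) assms(1) group_free_group by (simp add: group_hom_def group_hom_axioms_def)
  have "R \<subseteq> kernel free_group H h"
    using rel[OF h.group_hom_axioms h(2)] R by (auto simp: kernel_def)
  then have "normal_closure free_group R \<subseteq> kernel free_group H h"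
    unfolding normal_closure_def using h.normal_kernel by blast
  then obtain g where
    "g \<in> hom (free_group Mod normal_closure free_group R) H"
    "\<And>w. w \<in> carrier free_group \<Longrightarrow> g (normal_closure free_group R #>\<^bsub>free_group\<^esub> w) = h w"
    using h.FactGroup_universal_kernel[OF N.normal_axioms] by blast
  with h(2) show thesis
    by (intro that[of g]) (simp_all add: presented_group_def presented_gen_def)
qed

end

section \<open>Normal forms in class two\<close>

context group
begin

text \<open>Turns a commutator relation into an inverse-free rule for exchanging two factors, the
  form used in all later computations.\<close>

lemma commutator_eq_iff:
  assumes "a \<in> carrier G" "b \<in> carrier G" "c \<in> carrier G"
  shows "commutator G a b = c \<longleftrightarrow> a \<otimes> b = c \<otimes> (b \<otimes> a)"
  using assms by (simp add: commutator_def inv_solve_right') (simp add: m_assoc)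

lemma conj_int_pow:
  assumes "a \<in> carrier G" "g \<in> carrier G"
  shows "(g \<otimes> a \<otimes> inv g) [^] (i::int) = g \<otimes> a [^] i \<otimes> inv g"
proof -
  have "(\<lambda>a. g \<otimes> a \<otimes> inv g) \<in> hom G G"
    using assms(2) by (intro homI) (simp_all add: m_assoc inv_solve_left)
  from hom_int_pow[OF this assms(1)] is_group show ?thesis by simp
qed

text \<open>Conjugation by \<open>a\<close> sends \<open>b\<close> to \<open>c \<otimes> b\<close>,
  and since \<open>c\<close> and \<open>b\<close> commute, the power of this product splits.\<close>

lemma int_pow_swap:
  assumes carr: "a \<in> carrier G" "b \<in> carrier G" "c \<in> carrier G"
    and ab: "a \<otimes> b = c \<otimes> (b \<otimes> a)" and bc: "c \<otimes> b = b \<otimes> c"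
  shows "a \<otimes> b [^] (i::int) = c [^] i \<otimes> (b [^] i \<otimes> a)"
proof -
  have "a \<otimes> b \<otimes> inv a = c \<otimes> b"
    using carr ab by (simp add: inv_solve_right') (simp add: m_assoc)
  then have "a \<otimes> b [^] i \<otimes> inv a = c [^] i \<otimes> b [^] i"
    using conj_int_pow[of b a i] int_pow_mult_distrib[of c b i] carr bc by simp
  then show ?thesis
    using carr by (simp add: inv_solve_right') (simp add: m_assoc)
qed

lemma int_pow_commute:
  assumes "a \<in> carrier G" "b \<in> carrier G" "a \<otimes> b = b \<otimes> a"
  shows "a \<otimes> b [^] (i::int) = b [^] i \<otimes> a"
  using int_pow_swap[of a b \<one> i] assms by simp

text \<open>Two uses of \<open>int_pow_swap\<close>: the first moves \<open>x\<close> past a power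
  of \<open>y\<close>; solved for the opposite order, it shows that \<open>y [^] b\<close> and
  \<open>x\<close> exchange at the cost of \<open>z [^] (- b)\<close>, and the second use raises
  \<open>x\<close> to the power \<open>a\<close>.\<close>

lemma int_pow_swap2:
  assumes carr: "x \<in> carrier G" "y \<in> carrier G" "z \<in> carrier G"
    and xy: "x \<otimes> y = z \<otimes> (y \<otimes> x)"
    and xz: "x \<otimes> z = z \<otimes> x" and yz: "y \<otimes> z = z \<otimes> y"
  shows "y [^] (b::int) \<otimes> x [^] (a::int) = z [^] (- (b * a)) \<otimes> (x [^] a \<otimes> y [^] b)"
proof -
  have "x \<otimes> y [^] b = z [^] b \<otimes> (y [^] b \<otimes> x)"
    using int_pow_swap[OF carr xy] yz by simp
  then have "y [^] b \<otimes> x = z [^] (- b) \<otimes> (x \<otimes> y [^] b)"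
    using carr by (simp add: int_pow_neg inv_solve_left)
  then have "y [^] b \<otimes> x [^] a = (z [^] (- b)) [^] a \<otimes> (x [^] a \<otimes> y [^] b)"
    using carr int_pow_commute[OF carr(1,3) xz, of "- b"] by (intro int_pow_swap) simp_all
  then show ?thesis
    using carr by (simp add: int_pow_pow)
qed

text \<open>Since \<open>z\<close> commutes with \<open>x\<close> and \<open>y\<close>, the elements
  of this shape contain the generators and are closed under products and inverses.\<close>

lemma generate_normal_form:
  assumes carr: "x \<in> carrier G" "y \<in> carrier G" "z \<in> carrier G"
    and xy: "x \<otimes> y = z \<otimes> (y \<otimes> x)"
    and xz: "x \<otimes> z = z \<otimes> x" and yz: "y \<otimes> z = z \<otimes> y"
    and g: "g \<in> generate G {x, y, z}"
  shows "\<exists>(a::int) (b::int) (c::int). g = x [^] a \<otimes> y [^] b \<otimes> z [^] c"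
proof -
  define m where "m = (\<lambda>(a::int) (b::int) (c::int). x [^] a \<otimes> y [^] b \<otimes> z [^] c)"
  have m_closed: "m a b c \<in> carrier G" for a b c
    using carr by (simp add: m_def)
  have z_central: "z [^] c \<otimes> (x [^] a \<otimes> y [^] b) = x [^] a \<otimes> y [^] b \<otimes> z [^] c" for a b c :: int
  proof -
    have "z \<otimes> x [^] a = x [^] a \<otimes> z" "z \<otimes> y [^] b = y [^] b \<otimes> z"
      using int_pow_commute[of z] carr xz yz by auto
    then have "x [^] a \<otimes> y [^] b \<otimes> z = z \<otimes> (x [^] a \<otimes> y [^] b)"
      using carr by (metis int_pow_closed m_assoc)
    then show ?thesis
      using carr int_pow_commute[of "x [^] a \<otimes> y [^] b" z c] by simp
  qed
  have z_left: "z [^] c \<otimes> x [^] a = x [^] a \<otimes> z [^] c" "z [^] c \<otimes> y [^] b = y [^] b \<otimes> z [^] c"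
    for a b c :: int
    using z_central[of c a 0] z_central[of c 0 b] carr by simp_all
  \<comment> \<open>Powers of \<open>z\<close> move freely, and exchanging \<open>y [^] b\<close>
    with \<open>x [^] a'\<close> contributes \<open>- b * a'\<close> to the exponent of
    \<open>z\<close>. Reduced modulo n, this is the multiplication of
    \<open>heisenberg\<close>.\<close>
  have mult: "m a b c \<otimes> m a' b' c' = m (a + a') (b + b') (c + c' - b * a')" for a b c a' b' c'
  proof -
    have "m a b c \<otimes> m a' b' c' = x [^] a \<otimes> y [^] b \<otimes> (z [^] c \<otimes> (x [^] a' \<otimes> y [^] b')) \<otimes> z [^] c'"
      using carr by (simp add: m_def m_assoc)
    also have "\<dots> = x [^] a \<otimes> y [^] b \<otimes> (x [^] a' \<otimes> y [^] b' \<otimes> z [^] c) \<otimes> z [^] c'"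
      by (simp only: z_central)
    also have "\<dots> = x [^] a \<otimes> (y [^] b \<otimes> x [^] a') \<otimes> y [^] b' \<otimes> (z [^] c \<otimes> z [^] c')"
      using carr by (simp add: m_assoc)
    also have "\<dots> = x [^] a \<otimes> (x [^] a' \<otimes> y [^] b \<otimes> z [^] (- (b * a'))) \<otimes> y [^] b' \<otimes> (z [^] c \<otimes> z [^] c')"
      by (simp only: int_pow_swap2[OF carr xy xz yz] z_central)
    also have "\<dots> = x [^] a \<otimes> x [^] a' \<otimes> y [^] b \<otimes> (z [^] (- (b * a')) \<otimes> y [^] b') \<otimes> (z [^] c \<otimes> z [^] c')"
      using carr by (simp add: m_assoc)
    also have "\<dots> = x [^] a \<otimes> x [^] a' \<otimes> y [^] b \<otimes> (y [^] b' \<otimes> z [^] (- (b * a'))) \<otimes> (z [^] c \<otimes> z [^] c')"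
      by (simp only: z_left)
    also have "\<dots> = m (a + a') (b + b') (- (b * a') + (c + c'))"
      unfolding m_def int_pow_mult[OF carr(1)] int_pow_mult[OF carr(2)] int_pow_mult[OF carr(3)]
      using carr by (simp add: m_assoc)
    finally show ?thesis
      by (simp add: algebra_simps)
  qed
  \<comment> \<open>The summand \<open>- b * a\<close> offsets the correction term that
    \<open>mult\<close> produces.\<close>
  have inverse: "inv (m a b c) = m (- a) (- b) (- c - b * a)" for a b c
    using m_closed by (intro inv_equality) (simp_all add: mult, simp add: m_def)
  have gens: "\<exists>a b c. h = m a b c" if "h \<in> {x, y, z}" for h
  proof -
    have "x = m 1 0 0" "y = m 0 1 0" "z = m 0 0 1"
      using carr by (simp_all add: m_def)
    with that show ?thesis by blast
  qed
  have "\<exists>a b c. g = m a b c"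
    using g
  proof induction
    case one
    have "\<one> = m 0 0 0" by (simp add: m_def)
    then show ?case by blast
  next
    case (incl h)
    then show ?case by (rule gens)
  next
    case (inv h)
    then obtain a b c where "h = m a b c" using gens by blast
    then have "inv h = m (- a) (- b) (- c - b * a)" by (simp only: inverse)
    then show ?case by blast
  next
    case (eng h1 h2)
    then obtain a b c a' b' c' where "h1 = m a b c" "h2 = m a' b' c'" by blast
    then have "h1 \<otimes> h2 = m (a + a') (b + b') (c + c' - b * a')" by (simp only: mult)
    then show ?case by blast
  qed
  then show ?thesis
    by (simp add: m_def)
qed

lemma int_pow_mod:
  assumes "g \<in> carrier G" "g [^] n = \<one>"
  shows "g [^] (i mod int n) = g [^] i"
proof -
  have "g [^] i = g [^] (int n * (i div int n) + i mod int n)"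
    by simp
  also have "\<dots> = (g [^] n) [^] (i div int n) \<otimes> g [^] (i mod int n)"
    using assms(1) by (simp only: int_pow_mult int_pow_pow flip: int_pow_int)
  finally show ?thesis
    using assms by simp
qed

end

section \<open>The Heisenberg group modulo $n$\<close>

text \<open>The triple \<open>(a, b, c)\<close> stands for \<open>x\<^sup>a y\<^sup>b z\<^sup>c\<close>, with \<open>y x = x y z\<^sup>-\<^sup>1\<close>.\<close>

definition heisenberg :: "nat \<Rightarrow> (int \<times> int \<times> int) monoid" where
  "heisenberg n = \<lparr>carrier = {0..<int n} \<times> {0..<int n} \<times> {0..<int n},
     mult = (\<lambda>(a, b, c) (a', b', c').
       ((a + a') mod int n, (b + b') mod int n, (c + c' - b * a') mod int n)),
     one = (0, 0, 0)\<rparr>"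

lemma heisenberg_carrier:
  "carrier (heisenberg n) = {0..<int n} \<times> {0..<int n} \<times> {0..<int n}"
  and heisenberg_one: "\<one>\<^bsub>heisenberg n\<^esub> = (0, 0, 0)"
  and heisenberg_mult: "(a, b, c) \<otimes>\<^bsub>heisenberg n\<^esub> (a', b', c') =
     ((a + a') mod int n, (b + b') mod int n, (c + c' - b * a') mod int n)"
  by (simp_all add: heisenberg_def)

lemma card_heisenberg: "card (carrier (heisenberg n)) = n ^ 3"
  by (simp add: heisenberg_carrier card_cartesian_product power3_eq_cube)

lemma mod_diff_mod_eq:
  fixes u v w c n :: int
  shows "(u - v * (w mod n)) mod n = (u - v * w) mod n"
    and "(u - (w mod n) * v) mod n = (u - w * v) mod n"
    and "(c + u mod n - v) mod n = (c + u - v) mod n"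
    and "(u mod n + c - v) mod n = (u + c - v) mod n"
  by (metis mod_diff_right_eq mod_mult_right_eq, metis mod_diff_right_eq mod_mult_left_eq,
    metis mod_diff_left_eq mod_add_right_eq, metis mod_diff_left_eq mod_add_left_eq)

lemma group_heisenberg:
  assumes "n > 0"
  shows "group (heisenberg n)"
proof (rule groupI)
  fix g h k
  assume "g \<in> carrier (heisenberg n)" "h \<in> carrier (heisenberg n)" "k \<in> carrier (heisenberg n)"
  show "g \<otimes>\<^bsub>heisenberg n\<^esub> h \<otimes>\<^bsub>heisenberg n\<^esub> k =
      g \<otimes>\<^bsub>heisenberg n\<^esub> (h \<otimes>\<^bsub>heisenberg n\<^esub> k)"
    by (cases g; cases h; cases k) (simp add: heisenberg_mult mod_simps mod_diff_mod_eq algebra_simps)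
next
  fix g
  assume g: "g \<in> carrier (heisenberg n)"
  obtain a b c where [simp]: "g = (a, b, c)" by (cases g)
  show "\<one>\<^bsub>heisenberg n\<^esub> \<otimes>\<^bsub>heisenberg n\<^esub> g = g"
    using g by (simp add: heisenberg_one heisenberg_mult heisenberg_carrier)
  show "\<exists>h\<in>carrier (heisenberg n). h \<otimes>\<^bsub>heisenberg n\<^esub> g = \<one>\<^bsub>heisenberg n\<^esub>"
  proof
    show "(- a mod int n, - b mod int n, (- c - b * a) mod int n) \<in> carrier (heisenberg n)"
      using assms by (simp add: heisenberg_carrier)
    have "((- c - b * a) mod int n + c - (- b mod int n) * a) mod int n = 0"
      by (simp only: mod_diff_mod_eq) simp
    then show "(- a mod int n, - b mod int n, (- c - b * a) mod int n) \<otimes>\<^bsub>heisenberg n\<^esub> g = \<one>\<^bsub>heisenberg n\<^esub>"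
      by (simp add: heisenberg_one heisenberg_mult mod_simps)
  qed
next
  fix g h
  assume "g \<in> carrier (heisenberg n)" "h \<in> carrier (heisenberg n)"
  then show "g \<otimes>\<^bsub>heisenberg n\<^esub> h \<in> carrier (heisenberg n)"
    using assms by (cases g; cases h) (simp add: heisenberg_mult heisenberg_carrier)
qed (use assms in \<open>simp_all add: heisenberg_one heisenberg_carrier\<close>)

text \<open>Among the k factors there are \<open>k choose 2\<close> pairs in which the y-part of the
  earlier factor must pass the x-part of the later one, and each such exchange contributes
  \<open>- a * b\<close> to the last coordinate.\<close>

lemma heisenberg_nat_pow:
  "(a, b, c) [^]\<^bsub>heisenberg n\<^esub> (k::nat) =
    (int k * a mod int n, int k * b mod int n, (int k * c - int (k choose 2) * a * b) mod int n)"
proof (induction k)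
  case 0
  then show ?case by (simp add: heisenberg_one binomial_eq_0)
next
  case (Suc k)
  have "Suc k choose 2 = k + (k choose 2)"
    by (simp add: numeral_2_eq_2)
  then have "int k * c - int (k choose 2) * a * b + c - int k * b * a =
      int (Suc k) * c - int (Suc k choose 2) * a * b"
    by (simp add: algebra_simps)
  then have third: "((int k * c - int (k choose 2) * a * b) mod int n + c - (int k * b mod int n) * a) mod int n =
      (int (Suc k) * c - int (Suc k choose 2) * a * b) mod int n"
    by (simp only: mod_diff_mod_eq)
  have "(int k * d mod int n + d) mod int n = int (Suc k) * d mod int n" for d
    by (simp add: mod_simps algebra_simps)
  then show ?case
    by (simp only: nat_pow_Suc Suc heisenberg_mult third)
qed

text \<open>For odd n the binomial coefficient \<open>n choose 2\<close> is a multiple of n, so the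
  correction term of \<open>heisenberg_nat_pow\<close> vanishes along with the linear terms.\<close>

lemma heisenberg_exponent:
  assumes "odd n"
  shows "g [^]\<^bsub>heisenberg n\<^esub> n = \<one>\<^bsub>heisenberg n\<^esub>"
proof -
  have "n choose 2 = n * ((n - 1) div 2)"
    using assms by (simp add: choose_two div_mult_swap)
  then have "int n * c - int (n choose 2) * a * b = int n * (c - int ((n - 1) div 2) * a * b)" for a b c
    by (simp only: of_nat_mult right_diff_distrib mult.assoc)
  then show ?thesis
    by (cases g) (simp add: heisenberg_nat_pow heisenberg_one)
qed

text \<open>Cramer's rule modulo p: eliminating \<open>j\<close> from the two congruences leaves the
  determinant times \<open>i\<close>. In geometric terms, multiples of vectors on different lines
  agree only at zero.\<close>

lemma prime_dvd_of_indep_multiples: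
  fixes a b c d i j p :: int
  assumes "prime p" and "a * i mod p = c * j mod p" "b * i mod p = d * j mod p"
    and "\<not> p dvd a * d - b * c"
  shows "p dvd i"
proof -
  have "p dvd d * (a * i - c * j) - c * (b * i - d * j)"
    using assms(2,3) by (simp add: mod_eq_dvd_iff dvd_diff dvd_mult)
  also have "\<dots> = (a * d - b * c) * i"
    by (simp add: algebra_simps)
  finally show ?thesis
    using assms(1,4) by (simp add: prime_dvd_mult_iff)
qed

section \<open>Disjointness in groups of exponent $p$\<close>

context group
begin

text \<open>Modulo n, \<open>A\<close> is a homomorphism into an abelian group, so conjugation is
  invisible to it and powers become multiples.\<close>

lemma additive_mod_conj_pow:
  fixes A :: "'a \<Rightarrow> int"
  assumes A: "\<And>g h. g \<in> carrier G \<Longrightarrow> h \<in> carrier G \<Longrightarrow> A (g \<otimes> h) mod n = (A g + A h) mod n"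
    and carr: "w \<in> carrier G" "g \<in> carrier G"
  shows "A (conj_by G (w [^] (i::nat)) g) mod n = A w * int i mod n"
proof -
  \<comment> \<open>Additivity at the identity makes \<open>A \<one>\<close> congruent to its own
    double.\<close>
  have one: "n dvd A \<one>"
    using A[of \<one> \<one>] by (simp add: mod_eq_dvd_iff)
  have pow: "A (w [^] i) mod n = A w * int i mod n"
  proof (induction i)
    case 0
    then show ?case using one by simp
  next
    case (Suc i)
    have "A (w [^] Suc i) mod n = (A (w [^] i) mod n + A w) mod n"
      using A carr by (simp add: mod_simps)
    then show ?case by (simp add: Suc mod_simps algebra_simps)
  qed
  have inv: "n dvd A (inv g) + A g"
    using A[of "inv g" g] carr one by (simp add: dvd_eq_mod_eq_0)
  have "A (conj_by G (w [^] i) g) mod n = (A (inv g \<otimes> w [^] i) mod n + A g) mod n"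
    using A[of "inv g \<otimes> w [^] i" g] carr by (simp only: conj_by_def mod_add_left_eq m_closed inv_closed nat_pow_closed)
  also have "\<dots> = ((A (inv g) + A (w [^] i)) mod n + A g) mod n"
    by (simp only: A[OF inv_closed[OF carr(2)] nat_pow_closed[OF carr(1)]])
  also have "\<dots> = (A (w [^] i) + (A (inv g) + A g)) mod n"
    by (simp add: mod_simps algebra_simps)
  also have "\<dots> = A (w [^] i) mod n"
    using inv by auto
  finally show ?thesis using pow by simp
qed

text \<open>\<open>A\<close> and \<open>B\<close> serve as two coordinates modulo p that are
  constant on conjugacy classes. By \<open>indep\<close>, members of the two triples span different
  lines in the coordinate plane, so conjugate powers of them have exponents divisible by p and are
  trivial.\<close>

lemma beauville_Sigma_Int:
  fixes A B :: "'a \<Rightarrow> int" and p :: nat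
  assumes p: "prime p" and fin: "finite (carrier G)"
    and exponent: "\<And>g. g \<in> carrier G \<Longrightarrow> g [^] p = \<one>"
    and A: "\<And>g h. g \<in> carrier G \<Longrightarrow> h \<in> carrier G \<Longrightarrow> A (g \<otimes> h) mod int p = (A g + A h) mod int p"
    and B: "\<And>g h. g \<in> carrier G \<Longrightarrow> h \<in> carrier G \<Longrightarrow> B (g \<otimes> h) mod int p = (B g + B h) mod int p"
    and carr: "x1 \<in> carrier G" "y1 \<in> carrier G" "x2 \<in> carrier G" "y2 \<in> carrier G"
    and indep: "\<And>u v. u \<in> {x1, y1, x1 \<otimes> y1} \<Longrightarrow> v \<in> {x2, y2, x2 \<otimes> y2} \<Longrightarrow>
      \<not> int p dvd A u * B v - B u * A v"
  shows "beauville_Sigma G x1 y1 \<inter> beauville_Sigma G x2 y2 = {\<one>}"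
proof -
  have Sigma: "g \<in> beauville_Sigma G x y \<longleftrightarrow>
      (\<exists>i\<in>{1..order G}. \<exists>k\<in>carrier G. \<exists>w\<in>{x, y, x \<otimes> y}. g = conj_by G (w [^] i) k)" for g x y
    by (auto simp: beauville_Sigma_def)
  have conj_one: "conj_by G \<one> k = \<one>" if "k \<in> carrier G" for k
    using that by (simp add: conj_by_def)
  have one: "\<one> \<in> beauville_Sigma G x y" if "x \<in> carrier G" for x y
  proof -
    \<comment> \<open>Exponents start at 1, so the identity is obtained from the last exponent,
      \<open>order G\<close>, rather than from exponent 0.\<close>
    have "order G \<in> {1..order G}"
      using fin order_gt_0_iff_finite by (simp add: Suc_le_eq)
    moreover have "\<one> = conj_by G (x [^] order G) \<one>"
      using that by (simp add: pow_order_eq_1 conj_one)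
    ultimately show ?thesis
      unfolding Sigma by blast
  qed
  have "g = \<one>" if g1: "g \<in> beauville_Sigma G x1 y1" and g2: "g \<in> beauville_Sigma G x2 y2" for g
  proof -
    obtain i :: nat and k u where u: "k \<in> carrier G" "u \<in> {x1, y1, x1 \<otimes> y1}" "g = conj_by G (u [^] i) k"
      using g1 unfolding Sigma by blast
    obtain j :: nat and l v where v: "l \<in> carrier G" "v \<in> {x2, y2, x2 \<otimes> y2}" "g = conj_by G (v [^] j) l"
      using g2 unfolding Sigma by blast
    have uv: "u \<in> carrier G" "v \<in> carrier G"
      using u(2) v(2) carr by auto
    have "A u * int i mod int p = A v * int j mod int p" "B u * int i mod int p = B v * int j mod int p"
      using additive_mod_conj_pow[of A "int p", OF A uv(1) u(1), of i]
        additive_mod_conj_pow[of A "int p", OF A uv(2) v(1), of j]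
        additive_mod_conj_pow[of B "int p", OF B uv(1) u(1), of i]
        additive_mod_conj_pow[of B "int p", OF B uv(2) v(1), of j] u(3) v(3) by simp_all
    with p indep[OF u(2) v(2)] have "int p dvd int i"
      by (intro prime_dvd_of_indep_multiples[of "int p" "A u" _ "A v" _ "B u" "B v"]) simp_all
    then obtain m where "i = p * m"
      by auto
    then have "u [^] i = (u [^] p) [^] m"
      using uv(1) by (simp add: nat_pow_pow)
    then have "u [^] i = \<one>"
      using exponent[OF uv(1)] by simp
    with u(1,3) show ?thesis by (simp add: conj_one)
  qed
  with one carr show ?thesis by blast
qed

end

section \<open>The presented group\<close>

lemma (in group_hom) hom_commutator:
  assumes "a \<in> carrier G" "b \<in> carrier G"
  shows "h (commutator G a b) = commutator H (h a) (h b)"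
  using assms by (simp add: commutator_def)

lemma xyz_relators_carrier: "xyz_relators p \<subseteq> carrier free_group"
proof -
  interpret group "free_group :: xyz word set monoid" by (rule group_free_group)
  show ?thesis
    by (simp add: xyz_relators_def Let_def commutator_def)
qed

text \<open>Serves in both directions: applied to the projection it yields the relations in the
  presented group, and applied to the Heisenberg group it reduces the relators to computations with
  triples.\<close>

lemma xyz_relators_hom_iff:
  assumes "group_hom free_group H h"
    and x: "h (free_gen X) = x" and y: "h (free_gen Y) = y" and z: "h (free_gen Z) = z"
  shows "(\<forall>r\<in>xyz_relators p. h r = \<one>\<^bsub>H\<^esub>) \<longleftrightarrow>
    x [^]\<^bsub>H\<^esub> p = \<one>\<^bsub>H\<^esub> \<and> y [^]\<^bsub>H\<^esub> p = \<one>\<^bsub>H\<^esub> \<and> z [^]\<^bsub>H\<^esub> p = \<one>\<^bsub>H\<^esub> \<and>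
    x \<otimes>\<^bsub>H\<^esub> y = z \<otimes>\<^bsub>H\<^esub> (y \<otimes>\<^bsub>H\<^esub> x) \<and> x \<otimes>\<^bsub>H\<^esub> z = z \<otimes>\<^bsub>H\<^esub> x \<and> y \<otimes>\<^bsub>H\<^esub> z = z \<otimes>\<^bsub>H\<^esub> y"
proof -
  interpret h: group_hom free_group H h by fact
  have carr: "x \<in> carrier H" "y \<in> carrier H" "z \<in> carrier H"
    using x y z h.hom_closed[OF free_gen_closed] by auto
  have closed: "commutator free_group a b \<in> carrier free_group"
    if "a \<in> carrier free_group" "b \<in> carrier free_group" for a b :: "xyz word set"
    using that by (simp add: commutator_def)
  have "commutator H x y \<in> carrier H"
    using carr by (simp add: commutator_def)
  with carr have "commutator H x y \<otimes>\<^bsub>H\<^esub> inv\<^bsub>H\<^esub> z = \<one>\<^bsub>H\<^esub> \<longleftrightarrow> x \<otimes>\<^bsub>H\<^esub> y = z \<otimes>\<^bsub>H\<^esub> (y \<otimes>\<^bsub>H\<^esub> x)"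
    by (simp add: h.H.inv_solve_right' h.H.commutator_eq_iff)
  moreover have "commutator H a b = \<one>\<^bsub>H\<^esub> \<longleftrightarrow> a \<otimes>\<^bsub>H\<^esub> b = b \<otimes>\<^bsub>H\<^esub> a"
    if "a \<in> carrier H" "b \<in> carrier H" for a b
    using that by (simp add: h.H.commutator_eq_iff)
  ultimately show ?thesis
    using carr by (simp add: xyz_relators_def Let_def h.hom_nat_pow h.hom_commutator closed x y z)
qed

lemma group_xyz_group: "group (xyz_group p)"
  unfolding xyz_group_def by (rule group_presented_group[OF xyz_relators_carrier])

lemma generate_xyz_gen:
  "generate (xyz_group p) {xyz_gen p X, xyz_gen p Y, xyz_gen p Z} = carrier (xyz_group p)"
proof -
  have "(UNIV :: xyz set) = {X, Y, Z}"
    using xyz.exhaust by blast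
  then have "range (xyz_gen p) = {xyz_gen p X, xyz_gen p Y, xyz_gen p Z}"
    by (metis image_insert image_empty)
  then show ?thesis
    using generate_presented_gen[OF xyz_relators_carrier[of p]]
    by (simp add: xyz_group_def xyz_gen_def)
qed

lemma xyz_gen_closed [simp]: "xyz_gen p a \<in> carrier (xyz_group p)"
  by (cases a) (auto simp flip: generate_xyz_gen intro: generate.incl)

lemma xyz_group_relations:
  fixes p :: nat
  defines "G \<equiv> xyz_group p" and "x \<equiv> xyz_gen p X" and "y \<equiv> xyz_gen p Y" and "z \<equiv> xyz_gen p Z"
  shows "x [^]\<^bsub>G\<^esub> p = \<one>\<^bsub>G\<^esub>" "y [^]\<^bsub>G\<^esub> p = \<one>\<^bsub>G\<^esub>" "z [^]\<^bsub>G\<^esub> p = \<one>\<^bsub>G\<^esub>"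
    "x \<otimes>\<^bsub>G\<^esub> y = z \<otimes>\<^bsub>G\<^esub> (y \<otimes>\<^bsub>G\<^esub> x)" "x \<otimes>\<^bsub>G\<^esub> z = z \<otimes>\<^bsub>G\<^esub> x" "y \<otimes>\<^bsub>G\<^esub> z = z \<otimes>\<^bsub>G\<^esub> y"
  using xyz_relators_hom_iff[OF presented_group_proj_hom[OF xyz_relators_carrier[of p]] refl refl refl, of p]
    presented_group_proj_relator[OF xyz_relators_carrier[of p]]
  by (simp_all add: G_def x_def y_def z_def xyz_group_def xyz_gen_def presented_gen_def)

text \<open>The universal property supplies the homomorphism. The normal form with exponents reduced
  modulo p gives a map \<open>N\<close> back that is onto and is undone by \<open>\<phi>\<close>, so
  \<open>\<phi>\<close> is bijective.\<close>

lemma xyz_group_iso_heisenberg: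
  assumes "odd p" "p > 1"
  obtains \<phi> where "\<phi> \<in> iso (xyz_group p) (heisenberg p)"
    "\<phi> (xyz_gen p X) = (1, 0, 0)" "\<phi> (xyz_gen p Y) = (0, 1, 0)" "\<phi> (xyz_gen p Z) = (0, 0, 1)"
proof -
  let ?G = "xyz_group p" and ?x = "xyz_gen p X" and ?y = "xyz_gen p Y" and ?z = "xyz_gen p Z"
  interpret G: group ?G by (rule group_xyz_group)
  interpret H: group "heisenberg p" using assms by (intro group_heisenberg) simp
  have p_pos: "p > 0" using assms by simp
  define f where "f = case_xyz (1, 0, 0) (0, 1, 0) (0 :: int, 0 :: int, 1 :: int)"
  have f_closed: "f a \<in> carrier (heisenberg p)" for a
    using assms by (cases a) (simp_all add: f_def heisenberg_carrier)
  have rel: "h r = \<one>\<^bsub>heisenberg p\<^esub>"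
    if "group_hom free_group (heisenberg p) h" "\<And>a. h (free_gen a) = f a" "r \<in> xyz_relators p" for h r
  proof -
    have "\<forall>r\<in>xyz_relators p. h r = \<one>\<^bsub>heisenberg p\<^esub>"
      unfolding xyz_relators_hom_iff[OF that(1) that(2) that(2) that(2)]
      using assms by (simp add: f_def heisenberg_exponent heisenberg_mult mod_simps)
    with that(3) show ?thesis by blast
  qed
  obtain \<phi> where \<phi>: "\<phi> \<in> hom ?G (heisenberg p)" "\<And>a. \<phi> (xyz_gen p a) = f a"
    unfolding xyz_group_def xyz_gen_def
    using presented_group_universal[OF xyz_relators_carrier H.group_axioms, of f] f_closed rel by blast
  interpret \<phi>: group_hom ?G "heisenberg p" \<phi>
    by (simp add: group_hom_def group_hom_axioms_def G.group_axioms H.group_axioms \<phi>(1))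
  define N where "N = (\<lambda>(a :: int, b :: int, c :: int). ?x [^]\<^bsub>?G\<^esub> a \<otimes>\<^bsub>?G\<^esub> ?y [^]\<^bsub>?G\<^esub> b \<otimes>\<^bsub>?G\<^esub> ?z [^]\<^bsub>?G\<^esub> c)"
  have surj: "carrier ?G \<subseteq> N ` carrier (heisenberg p)"
  proof
    fix g assume "g \<in> carrier ?G"
    then obtain a b c :: int where "g = N (a, b, c)"
      using G.generate_normal_form[OF _ _ _ xyz_group_relations(4-6)[of p]]
      unfolding generate_xyz_gen N_def by simp blast
    then have "g = N (a mod int p, b mod int p, c mod int p)"
      by (simp add: N_def G.int_pow_mod xyz_group_relations)
    moreover have "(a mod int p, b mod int p, c mod int p) \<in> carrier (heisenberg p)"
      using p_pos by (simp add: heisenberg_carrier)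
    ultimately show "g \<in> N ` carrier (heisenberg p)"
      by blast
  qed
  have \<phi>_N: "\<phi> (N t) = t" if "t \<in> carrier (heisenberg p)" for t
  proof -
    obtain a b c where abc: "t = (a, b, c)" by (cases t)
    \<comment> \<open>Entries of carrier triples are nonnegative, so the powers in \<open>N\<close>
      are natural powers and \<open>heisenberg_nat_pow\<close> applies; the bounds by p make the
      resulting residues equal to the entries.\<close>
    with that have "t = (int (nat a), int (nat b), int (nat c))" "nat a < p" "nat b < p" "nat c < p"
      by (auto simp: heisenberg_carrier)
    then obtain i j k where "t = (int i, int j, int k)" "i < p" "j < p" "k < p"
      by blast
    then show ?thesis
      by (simp add: N_def \<phi>(2) f_def int_pow_int \<phi>.hom_nat_pow heisenberg_nat_pow heisenberg_mult)
  qed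
  have "inj_on \<phi> (carrier ?G)"
    by (rule inj_on_subset[OF _ surj]) (auto intro: inj_onI simp: \<phi>_N)
  moreover have "\<phi> ` carrier ?G = carrier (heisenberg p)"
  proof
    show "carrier (heisenberg p) \<subseteq> \<phi> ` carrier ?G"
    proof
      fix t assume "t \<in> carrier (heisenberg p)"
      moreover have "N t \<in> carrier ?G"
        by (cases t) (simp add: N_def)
      ultimately show "t \<in> \<phi> ` carrier ?G"
        using \<phi>_N by (metis imageI)
    qed
  qed auto
  ultimately have "\<phi> \<in> iso ?G (heisenberg p)"
    by (simp add: iso_def bij_betw_def \<phi>(1))
  then show thesis
    by (rule that) (simp_all add: \<phi>(2) f_def)
qed

theorem lemma13:
  fixes p :: nat
  assumes "prime p" and "p \<ge> 7"
  shows "let G = xyz_group p; x = xyz_gen p X; y = xyz_gen p Y in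
    \<not> comm_group G \<and>
    beauville_group G \<and>
    order G = p ^ 3 \<and>
    beauville_structure G x y
      (x \<otimes>\<^bsub>G\<^esub> y [^]\<^bsub>G\<^esub> (2::nat)) (x \<otimes>\<^bsub>G\<^esub> y [^]\<^bsub>G\<^esub> (3::nat))"
proof -
  define G where "G = xyz_group p"
  define x where "x = xyz_gen p X"
  define y where "y = xyz_gen p Y"
  define z where "z = xyz_gen p Z"
  interpret G: group G unfolding G_def by (rule group_xyz_group)
  have p1: "p > 1"
    using assms(2) by simp
  have odd: "odd p"
    using assms by (intro prime_odd_nat) simp_all
  have carr [simp]: "x \<in> carrier G" "y \<in> carrier G" "z \<in> carrier G"
    by (simp_all add: G_def x_def y_def z_def)
  have xy: "x \<otimes>\<^bsub>G\<^esub> y = z \<otimes>\<^bsub>G\<^esub> (y \<otimes>\<^bsub>G\<^esub> x)"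
    using xyz_group_relations(4) by (simp add: G_def x_def y_def z_def)
  obtain \<phi> where iso: "\<phi> \<in> iso G (heisenberg p)"
    and \<phi>: "\<phi> x = (1, 0, 0)" "\<phi> y = (0, 1, 0)" "\<phi> z = (0, 0, 1)"
    using xyz_group_iso_heisenberg[OF odd p1] unfolding G_def x_def y_def z_def by blast
  interpret \<phi>: group_hom G "heisenberg p" \<phi>
    using iso assms(2) by (simp add: group_hom_def group_hom_axioms_def G.group_axioms group_heisenberg iso_def)
  have inj: "inj_on \<phi> (carrier G)"
    using iso by (simp add: iso_def bij_betw_def)
  have order: "order G = p ^ 3"
    using iso bij_betw_same_card[of \<phi> "carrier G" "carrier (heisenberg p)"]
    by (simp add: order_def iso_def card_heisenberg)
  then have fin: "finite (carrier G)"
    using assms(2) G.order_gt_0_iff_finite by simp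
  \<comment> \<open>The exponent is pulled back from the Heisenberg group along the injective
    \<open>\<phi>\<close>.\<close>
  have exponent: "g [^]\<^bsub>G\<^esub> p = \<one>\<^bsub>G\<^esub>" if "g \<in> carrier G" for g
    using that by (intro inj_onD[OF inj]) (simp_all add: \<phi>.hom_nat_pow heisenberg_exponent odd)
  have "z \<noteq> \<one>\<^bsub>G\<^esub>"
    using \<phi>(3) \<phi>.hom_one by (auto simp: heisenberg_one)
  then have noncomm: "\<not> comm_group G"
  proof (rule contrapos_nn)
    assume "comm_group G"
    then have "x \<otimes>\<^bsub>G\<^esub> y = y \<otimes>\<^bsub>G\<^esub> x"
      by (simp add: comm_groupE(4))
    with xy have "z \<otimes>\<^bsub>G\<^esub> (y \<otimes>\<^bsub>G\<^esub> x) = y \<otimes>\<^bsub>G\<^esub> x"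
      by simp
    then show "z = \<one>\<^bsub>G\<^esub>"
      by simp
  qed

  let ?x2 = "x \<otimes>\<^bsub>G\<^esub> y [^]\<^bsub>G\<^esub> (2::nat)" and ?y2 = "x \<otimes>\<^bsub>G\<^esub> y [^]\<^bsub>G\<^esub> (3::nat)"
  \<comment> \<open>It suffices to reach \<open>x\<close> and \<open>y\<close>, because
    \<open>z\<close> is their commutator.\<close>
  have gen: "generate G {u, v} = carrier G"
    if uv: "u \<in> carrier G" "v \<in> carrier G" and "x \<in> generate G {u, v}" "y \<in> generate G {u, v}" for u v
  proof -
    interpret S: subgroup "generate G {u, v}" G
      using uv by (intro G.generate_is_subgroup) simp
    have "z = x \<otimes>\<^bsub>G\<^esub> y \<otimes>\<^bsub>G\<^esub> inv\<^bsub>G\<^esub> (y \<otimes>\<^bsub>G\<^esub> x)"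
      using xy by (simp add: G.inv_solve_right del: G.inv_mult_group)
    then have "z \<in> generate G {u, v}"
      using that(3,4) by (metis S.m_closed S.m_inv_closed)
    with that(3,4) have "generate G {x, y, z} \<subseteq> generate G {u, v}"
      using S.subgroup_axioms by (intro G.generate_subgroup_incl) simp_all
    then show ?thesis
      using S.subset generate_xyz_gen[of p] by (auto simp: G_def x_def y_def z_def)
  qed
  have gen1: "generate G {x, y} = carrier G"
    by (intro gen) (auto intro: generate.incl)
  have gen2: "generate G {?x2, ?y2} = carrier G"
  proof (rule gen)
    interpret S: subgroup "generate G {?x2, ?y2}" G
      by (intro G.generate_is_subgroup) simp
    have mem: "?x2 \<in> generate G {?x2, ?y2}" "?y2 \<in> generate G {?x2, ?y2}"
      by (auto intro: generate.incl)
    \<comment> \<open>The two elements of the second pair differ by a right factor \<open>y\<close>.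
      This recovers \<open>y\<close>, and cancelling its square from \<open>?x2\<close> recovers
      \<open>x\<close>.\<close>
    have "?x2 \<otimes>\<^bsub>G\<^esub> y = ?y2"
      by (simp add: numeral_3_eq_3 numeral_2_eq_2 G.m_assoc)
    then have "y = inv\<^bsub>G\<^esub> ?x2 \<otimes>\<^bsub>G\<^esub> ?y2"
      by (subst G.inv_solve_left) simp_all
    with mem show y: "y \<in> generate G {?x2, ?y2}"
      by (metis S.m_closed S.m_inv_closed)
    have "x = ?x2 \<otimes>\<^bsub>G\<^esub> inv\<^bsub>G\<^esub> (y \<otimes>\<^bsub>G\<^esub> y)"
      by (subst G.inv_solve_right) (simp_all add: numeral_2_eq_2)
    with mem y show "x \<in> generate G {?x2, ?y2}"
      by (metis S.m_closed S.m_inv_closed)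
  qed simp_all

  have "beauville_Sigma G x y \<inter> beauville_Sigma G ?x2 ?y2 = {\<one>\<^bsub>G\<^esub>}"
  \<comment> \<open>The first two Heisenberg coordinates add modulo p; only the third has a mixed
    term.\<close>
  proof (rule G.beauville_Sigma_Int[where A = "\<lambda>g. fst (\<phi> g)" and B = "\<lambda>g. fst (snd (\<phi> g))"])
    fix g h assume "g \<in> carrier G" "h \<in> carrier G"
    then show "fst (\<phi> (g \<otimes>\<^bsub>G\<^esub> h)) mod int p = (fst (\<phi> g) + fst (\<phi> h)) mod int p"
      and "fst (snd (\<phi> (g \<otimes>\<^bsub>G\<^esub> h))) mod int p = (fst (snd (\<phi> g)) + fst (snd (\<phi> h))) mod int p"
      by (cases "\<phi> g"; cases "\<phi> h"; simp add: heisenberg_mult)+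
  next
    fix u v
    assume "u \<in> {x, y, x \<otimes>\<^bsub>G\<^esub> y}" "v \<in> {?x2, ?y2, ?x2 \<otimes>\<^bsub>G\<^esub> ?y2}"
    \<comment> \<open>The determinants of (1,0), (0,1), (1,1) against (1,2), (1,3), (2,5) are 2, 3,
      5, then -1, -1, -2, then 1, 2, 3. All are nonzero and below 7 in absolute value, and the
      coordinates are already reduced because p is at least 7.\<close>
    moreover have "\<not> int p dvd k" if "k \<noteq> 0" "\<bar>k\<bar> < 7" for k
      using that dvd_imp_le_int[of k "int p"] assms(2) by auto
    ultimately show "\<not> int p dvd fst (\<phi> u) * fst (snd (\<phi> v)) - fst (snd (\<phi> u)) * fst (\<phi> v)"
      using assms(2) by (auto simp: \<phi> \<phi>.hom_nat_pow heisenberg_nat_pow heisenberg_mult)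
  qed (use assms fin exponent in simp_all)
  with gen1 gen2 have beauville: "beauville_structure G x y ?x2 ?y2"
    by (simp add: beauville_structure_def)
  then have "beauville_group G"
    using fin G.group_axioms by (auto simp: beauville_group_def)
  with noncomm order beauville show ?thesis
    by (simp add: Let_def G_def x_def y_def)
qed

end
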